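(* For all positive integers $k$ and all graphs $G$, $$CAN(K_{\omega(G)},k)\;\le\; CAN(G,k)\;\le\; CAN(K_{\chi(G)},k).$$
   Context: Graphs are finite and simple; $\omega(G)$ is the maximum clique size, $\chi(G)$ the chromatic number, and $K_m$ the complete graph on $m$ vertices. Two vectors $u,v\in\{0,1,\dots,k-1\}^n$ are qualitatively independent if for every ordered pair $(a,b)\in\{0,\dots,k-1\}^2$ there is an index $i$ with $(u_i,v_i)=(a,b)$. A covering array on the graph $G$, denoted $CA(n,G,k)$, is a $|V(G)|\times n$ array with entries from $\{0,\dots,k-1\}$ whose rows correspond to the vertices of $G$, such that any two rows corresponding to adjacent vertices of $G$ are qualitatively independent. $CAN(G,k)$ is the smallest positive integer $n$ such that a $CA(n,G,k)$ exists. *)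

theory Defs
  imports "Graph_Theory.Graph_Theory"
begin

text \<open>
  Finite simple graphs are the locale \<^locale>\<open>graph\<close>: finite, symmetric digraphs
  without loops or parallel arcs. Adjacency of \<open>u\<close> and \<open>v\<close> is \<open>u \<rightarrow>\<^bsub>G\<^esub> v\<close>.
\<close>

definition is_clique :: "('a, 'b) pre_digraph \<Rightarrow> 'a set \<Rightarrow> bool" where
  "is_clique G S \<longleftrightarrow> S \<subseteq> verts G \<and> (\<forall>u\<in>S. \<forall>v\<in>S. u \<noteq> v \<longrightarrow> u \<rightarrow>\<^bsub>G\<^esub> v)"

definition clique_number :: "('a, 'b) pre_digraph \<Rightarrow> nat" where
  "clique_number G = Max (card ` {S. is_clique G S})"

definition proper_colouring :: "('a, 'b) pre_digraph \<Rightarrow> nat \<Rightarrow> ('a \<Rightarrow> nat) \<Rightarrow> bool" where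
  "proper_colouring G c f \<longleftrightarrow>
     (\<forall>v\<in>verts G. f v < c) \<and> (\<forall>u v. u \<rightarrow>\<^bsub>G\<^esub> v \<longrightarrow> f u \<noteq> f v)"

definition chromatic_number :: "('a, 'b) pre_digraph \<Rightarrow> nat" where
  "chromatic_number G = (LEAST c. \<exists>f. proper_colouring G c f)"

definition complete_graph :: "nat \<Rightarrow> (nat, nat \<times> nat) pre_digraph" where
  "complete_graph m =
     \<lparr> verts = {..<m}, arcs = {(i, j). i < m \<and> j < m \<and> i \<noteq> j}, tail = fst, head = snd \<rparr>"

text \<open>
  A vector of length \<open>n\<close> is a function on \<^typ>\<open>nat\<close> of which only the values at
  indices below \<open>n\<close> matter. An array has one such vector (its row) per vertex.
\<close>

definition qualitatively_independent ::
  "nat \<Rightarrow> nat \<Rightarrow> (nat \<Rightarrow> nat) \<Rightarrow> (nat \<Rightarrow> nat) \<Rightarrow> bool" where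
  "qualitatively_independent n k u v \<longleftrightarrow> (\<forall>a<k. \<forall>b<k. \<exists>i<n. u i = a \<and> v i = b)"

definition covering_array ::
  "nat \<Rightarrow> ('a, 'b) pre_digraph \<Rightarrow> nat \<Rightarrow> ('a \<Rightarrow> nat \<Rightarrow> nat) \<Rightarrow> bool" where
  "covering_array n G k C \<longleftrightarrow>
     (\<forall>v\<in>verts G. \<forall>i<n. C v i < k) \<and>
     (\<forall>u v. u \<rightarrow>\<^bsub>G\<^esub> v \<longrightarrow> qualitatively_independent n k (C u) (C v))"

definition CAN :: "('a, 'b) pre_digraph \<Rightarrow> nat \<Rightarrow> nat" where
  "CAN G k = (LEAST n. 0 < n \<and> (\<exists>C. covering_array n G k C))"

lemma complete_digraph_complete_graph: "complete_digraph m (complete_graph m)"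
proof -
  let ?H = "\<lparr> pverts = {..<m}, parcs = {(i, j). i < m \<and> j < m \<and> i \<noteq> j} \<rparr>"
  have "complete_graph m = with_proj ?H"
    by (simp add: complete_graph_def with_proj_def)
  moreover have "complete_digraph m (with_proj ?H)"
    unfolding complete_digraph_pair_def by auto
  ultimately show ?thesis by simp
qed

text \<open>For finite simple graphs the \<open>Max\<close> above is over a finite nonempty set, and the two \<open>LEAST\<close>s are attained (for \<open>CAN\<close>, when \<open>0 < k\<close>).\<close>

lemma (in graph) cliques_finite_nonempty:
  "finite {S. is_clique G S}" "{S. is_clique G S} \<noteq> {}"
proof -
  have "{S. is_clique G S} \<subseteq> Pow (verts G)" by (auto simp: is_clique_def)
  then show "finite {S. is_clique G S}" by (rule finite_subset) simp
  have "is_clique G {}" by (simp add: is_clique_def)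
  then show "{S. is_clique G S} \<noteq> {}" by blast
qed

lemma (in graph) proper_colouring_exists: "\<exists>c f. proper_colouring G c f"
proof -
  obtain f where f: "bij_betw f (verts G) {0..<card (verts G)}"
    using ex_bij_betw_finite_nat finite_verts by blast
  have "f u \<noteq> f v" if uv: "u \<rightarrow>\<^bsub>G\<^esub> v" for u v
  proof -
    have "u \<noteq> v" using uv adj_not_same by blast
    moreover have "u \<in> verts G" "v \<in> verts G" using adj_in_verts[OF uv] by simp_all
    ultimately show ?thesis using bij_betw_imp_inj_on[OF f] by (simp add: inj_on_eq_iff)
  qed
  moreover have "f v < card (verts G)" if "v \<in> verts G" for v
    using bij_betw_apply[OF f that] by simp
  ultimately have "proper_colouring G (card (verts G)) f"
    by (simp add: proper_colouring_def)
  then show ?thesis by blast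
qed

lemma (in graph) covering_array_exists:
  assumes "0 < k"
  shows "\<exists>n>0. \<exists>C. covering_array n G k C"
proof -
  let ?P = "verts G \<rightarrow>\<^sub>E {..<k}"
  have fin: "finite ?P" by (simp add: finite_PiE)
  have ne: "?P \<noteq> {}" using assms by (auto simp: PiE_eq_empty_iff)
  obtain h where h: "bij_betw h {0..<card ?P} ?P"
    using ex_bij_betw_nat_finite[OF fin] by blast
  have "qualitatively_independent (card ?P) k (\<lambda>i. h i u) (\<lambda>i. h i v)" if uv: "u \<rightarrow>\<^bsub>G\<^esub> v" for u v
    unfolding qualitatively_independent_def
  proof (intro allI impI)
    fix a b assume ab: "a < k" "b < k"
    have "u \<noteq> v" "u \<in> verts G" "v \<in> verts G"
      using uv adj_not_same adj_in_verts[OF uv] by auto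
    define g where "g = (\<lambda>x\<in>verts G. if x = u then a else b)"
    have "g \<in> ?P" using ab by (auto simp: g_def)
    then have "g \<in> h ` {0..<card ?P}" using bij_betw_imp_surj_on[OF h] by (simp only:)
    then obtain i where i: "i \<in> {0..<card ?P}" and g: "g = h i" by (rule imageE)
    have "h i u = a" "h i v = b"
      unfolding g[symmetric] g_def
      using \<open>u \<noteq> v\<close> \<open>u \<in> verts G\<close> \<open>v \<in> verts G\<close> by simp_all
    moreover have "i < card ?P" using i by (simp only: atLeastLessThan_iff)
    ultimately show "\<exists>i<card ?P. h i u = a \<and> h i v = b" by blast
  qed
  moreover have "h i v < k" if "v \<in> verts G" "i < card ?P" for v i
  proof -
    have "h i \<in> ?P" by (rule bij_betw_apply[OF h]) (simp only: atLeastLessThan_iff that(2) le0 simp_thms)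
    then have "h i v \<in> {..<k}" using that(1) by (rule PiE_mem)
    then show ?thesis by simp
  qed
  ultimately have "covering_array (card ?P) G k (\<lambda>v i. h i v)"
    by (simp add: covering_array_def)
  moreover have "0 < card ?P" using fin ne by (simp add: card_gt_0_iff)
  ultimately show ?thesis by blast
qed

end

theory Submission
  imports Defs
begin

text \<open>
  Covering arrays pull back along graph homomorphisms: if \<open>f\<close> maps \<open>G\<close> to \<open>H\<close> and \<open>C\<close> is a
  covering array on \<open>H\<close>, then giving each vertex \<open>v\<close> of \<open>G\<close> the row \<open>C (f v)\<close> yields a covering
  array on \<open>G\<close> with the same number of columns, because adjacent vertices of \<open>G\<close> receive rows of
  adjacent vertices of \<open>H\<close>. So \<open>CAN\<close> can only grow along a homomorphism
  (\<open>CAN_le_of_homomorphism\<close>). Both inequalities are instances: a clique of size \<open>m\<close> in \<open>G\<close> is a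
  homomorphism from the complete graph on \<open>m\<close> vertices to \<open>G\<close>, and a proper colouring of \<open>G\<close>
  with \<open>m\<close> colours is a homomorphism from \<open>G\<close> to that complete graph. It remains to choose a
  clique of maximum size and a colouring with as few colours as possible.
\<close>

definition graph_homomorphism ::
  "('a, 'b) pre_digraph \<Rightarrow> ('c, 'd) pre_digraph \<Rightarrow> ('a \<Rightarrow> 'c) \<Rightarrow> bool" where
  "graph_homomorphism G H f \<longleftrightarrow>
     f ` verts G \<subseteq> verts H \<and> (\<forall>u v. u \<rightarrow>\<^bsub>G\<^esub> v \<longrightarrow> f u \<rightarrow>\<^bsub>H\<^esub> f v)"

lemma covering_array_pullback:
  assumes "graph_homomorphism G H f" "covering_array n H k C"
  shows "covering_array n G k (C \<circ> f)"
  using assms by (auto simp: graph_homomorphism_def covering_array_def)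

text \<open>
  The hypotheses on the target and on \<open>k\<close> guarantee that a covering array on \<open>H\<close> exists, so that the
  minimum \<open>CAN H k\<close> is attained by an array that can be pulled back.
\<close>

lemma CAN_le_of_homomorphism:
  assumes "graph H" "0 < k" "graph_homomorphism G H f"
  shows "CAN G k \<le> CAN H k"
proof -
  have "\<exists>n. 0 < n \<and> (\<exists>C. covering_array n H k C)"
    using graph.covering_array_exists[OF assms(1,2)] by blast
  then have "0 < CAN H k \<and> (\<exists>C. covering_array (CAN H k) H k C)"
    unfolding CAN_def by (rule LeastI_ex)
  then have "0 < CAN H k \<and> (\<exists>C. covering_array (CAN H k) G k C)"
    using covering_array_pullback[OF assms(3)] by blast
  then show ?thesis
    unfolding CAN_def[of G] by (rule Least_le)
qed

lemma graph_complete_graph: "graph (complete_graph m)"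
  using complete_digraph_complete_graph by (simp add: complete_digraph_def)

lemma verts_complete_graph [simp]: "verts (complete_graph m) = {..<m}"
  by (simp add: complete_graph_def)

lemma adj_complete_graph [simp]:
  "i \<rightarrow>\<^bsub>complete_graph m\<^esub> j \<longleftrightarrow> i < m \<and> j < m \<and> i \<noteq> j"
  by (auto simp: complete_graph_def arcs_ends_def arc_to_ends_def)

text \<open>Any enumeration of a clique preserves adjacency, as distinct clique members are adjacent.\<close>

lemma is_clique_imp_homomorphism:
  assumes "finite S" "is_clique G S"
  obtains f where "graph_homomorphism (complete_graph (card S)) G f"
proof -
  obtain f where f: "bij_betw f {0..<card S} S"
    using ex_bij_betw_nat_finite[OF assms(1)] by blast
  have mem: "f i \<in> S" if "i < card S" for i
    using bij_betw_apply[OF f] that by simp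
  have "f i \<noteq> f j" if "i < card S" "j < card S" "i \<noteq> j" for i j
    using bij_betw_imp_inj_on[OF f] that by (simp add: inj_on_eq_iff)
  with mem assms(2) have "graph_homomorphism (complete_graph (card S)) G f"
    by (auto simp: graph_homomorphism_def is_clique_def)
  then show thesis by (rule that)
qed

lemma (in graph) proper_colouring_imp_homomorphism:
  assumes "proper_colouring G m f"
  shows "graph_homomorphism G (complete_graph m) f"
  using assms adj_in_verts by (auto simp: graph_homomorphism_def proper_colouring_def)

lemma (in graph) maximum_clique_exists:
  obtains S where "finite S" "is_clique G S" "card S = clique_number G"
proof -
  have "clique_number G \<in> card ` {S. is_clique G S}"
    unfolding clique_number_def using cliques_finite_nonempty by (intro Max_in) auto
  then obtain S where S: "is_clique G S" "card S = clique_number G" by auto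
  moreover have "finite S"
    using S(1) finite_subset[OF _ finite_verts] by (simp add: is_clique_def)
  ultimately show thesis using that by blast
qed

lemma (in graph) optimal_colouring_exists:
  obtains f where "proper_colouring G (chromatic_number G) f"
  using LeastI_ex[OF proper_colouring_exists] that unfolding chromatic_number_def by blast

theorem corollary5p1p2:
  fixes G :: "('a, 'b) pre_digraph" and k :: nat
  assumes "graph G" and "0 < k"
  shows "CAN (complete_graph (clique_number G)) k \<le> CAN G k
       \<and> CAN G k \<le> CAN (complete_graph (chromatic_number G)) k"
proof
  interpret graph G by fact
  obtain S where S: "finite S" "is_clique G S" "card S = clique_number G"
    by (rule maximum_clique_exists)
  obtain f where "graph_homomorphism (complete_graph (clique_number G)) G f"
    using is_clique_imp_homomorphism[OF S(1,2)] S(3) by metis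
  with assms show "CAN (complete_graph (clique_number G)) k \<le> CAN G k"
    by (rule CAN_le_of_homomorphism)
  obtain g where "proper_colouring G (chromatic_number G) g"
    by (rule optimal_colouring_exists)
  then show "CAN G k \<le> CAN (complete_graph (chromatic_number G)) k"
    using CAN_le_of_homomorphism[OF graph_complete_graph assms(2)]
      proper_colouring_imp_homomorphism by blast
qed

end
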